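(* Let $\mathcal C_F^2$ be the collection of all $C\subseteq\mathbb N^2$ for which the limit $$\mu(C)=\lim_{\min(n_1,n_2)\to\infty}\frac{\#(C\cap([n_1]\times[n_2]))}{n_1n_2}$$ exists. Then $(\mathcal C_F^2,\mu)$ can be extended to $2^{\mathbb N^2}$; that is, there exists a finitely additive probability on all subsets of $\mathbb N^2$ which agrees with $\mu$ on $\mathcal C_F^2$.
   Context: $\mathbb N=\{1,2,3,\dots\}$ and $[n]=\{1,\dots,n\}$. A finitely additive probability on a set $\Omega$ is a function $\nu:2^{\Omega}\to[0,1]$ with $\nu(\Omega)=1$ and $\nu(A\cup B)=\nu(A)+\nu(B)$ for disjoint $A,B\subseteq\Omega$. *)

theory Defs
  imports "HOL-Analysis.Analysis"
begin

definition finitely_additive_probability :: "'a set \<Rightarrow> ('a set \<Rightarrow> real) \<Rightarrow> bool" where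
  "finitely_additive_probability \<Omega> \<nu> \<longleftrightarrow>
     \<nu> \<in> Pow \<Omega> \<rightarrow> {0..1} \<and> \<nu> \<Omega> = 1 \<and>
     (\<forall>A B. A \<subseteq> \<Omega> \<and> B \<subseteq> \<Omega> \<and> A \<inter> B = {} \<longrightarrow> \<nu> (A \<union> B) = \<nu> A + \<nu> B)"

(* The natural numbers of the source start at 1. *)
definition pos_nat2 :: "(nat \<times> nat) set" where
  "pos_nat2 = {1..} \<times> {1..}"

(* The filter of "min n1 n2 tends to infinity". *)
definition min_at_top :: "(nat \<times> nat) filter" where
  "min_at_top = filtercomap (\<lambda>(n1, n2). min n1 n2) at_top"

lemma eventually_min_at_top:
  "eventually P min_at_top \<longleftrightarrow> (\<exists>N. \<forall>n1\<ge>N. \<forall>n2\<ge>N. P (n1, n2))"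
  unfolding min_at_top_def eventually_filtercomap_at_top_linorder by auto

lemma min_at_top_neq_bot: "min_at_top \<noteq> bot"
  unfolding trivial_limit_def eventually_min_at_top by auto

definition freq2 :: "(nat \<times> nat) set \<Rightarrow> nat \<times> nat \<Rightarrow> real" where
  "freq2 C = (\<lambda>(n1, n2). real (card (C \<inter> ({1..n1} \<times> {1..n2}))) / (real n1 * real n2))"

definition C_F2 :: "(nat \<times> nat) set set" where
  "C_F2 = {C. C \<subseteq> pos_nat2 \<and> (\<exists>l. (freq2 C \<longlongrightarrow> l) min_at_top)}"

definition mu2 :: "(nat \<times> nat) set \<Rightarrow> real" where
  "mu2 C = Lim min_at_top (freq2 C)"

end

theory Submission
  imports Defs
begin

text \<open>
  By Tychonoff's theorem the frequencies of all sets converge simultaneously along some proper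
  filter finer than \<^const>\<open>min_at_top\<close>. Their limits inherit finite additivity from the
  frequencies, and they agree with the limit along \<^const>\<open>min_at_top\<close> whenever that exists.
\<close>

lemma compact_PiE_UNIV:
  fixes K :: "'i \<Rightarrow> 'b::topological_space set"
  assumes "\<And>i. compact (K i)"
  shows "compact (PiE UNIV K)"
proof -
  \<comment> \<open>Tychonoff for the abstract product topology; over the index set
    \<open>UNIV\<close> this is the type-class topology on functions.\<close>
  have "compactin (product_topology (\<lambda>_. euclidean) UNIV) (PiE UNIV K)"
    unfolding compactin_PiE using assms by simp
  then show ?thesis
    by (simp add: euclidean_product_topology)
qed

text \<open>Bundling the family into one map into a compact product reduces this to a cluster point
  \<open>l\<close> of the image filter: the preimages of neighbourhoods of \<open>l\<close> are
  compatible with \<open>F\<close>, and together with \<open>F\<close> they generate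
  \<open>G\<close>.\<close>

lemma simultaneously_convergent_subfilter:
  fixes f :: "'i \<Rightarrow> 'a \<Rightarrow> 'b::topological_space"
  assumes "F \<noteq> bot" and K: "\<And>i. compact (K i)"
    and f: "\<forall>\<^sub>F x in F. \<forall>i. f i x \<in> K i"
  obtains G l where "G \<le> F" "G \<noteq> bot" "\<And>i. l i \<in> K i" "\<And>i. (f i \<longlongrightarrow> l i) G"
proof -
  define \<Phi> where "\<Phi> = (\<lambda>x i. f i x)"
  have "compact (PiE UNIV K)"
    using K by (rule compact_PiE_UNIV)
  moreover have "filtermap \<Phi> F \<noteq> bot"
    using assms(1) by (simp add: filtermap_bot_iff)
  moreover have "\<forall>\<^sub>F y in filtermap \<Phi> F. y \<in> PiE UNIV K"
    using f by (simp add: eventually_filtermap \<Phi>_def PiE_UNIV_domain Pi_iff)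
  ultimately obtain l where l: "l \<in> PiE UNIV K" "inf (nhds l) (filtermap \<Phi> F) \<noteq> bot"
    unfolding compact_filter by blast
  define G where "G = inf (filtercomap \<Phi> (nhds l)) F"
  have "G \<noteq> bot"
  proof
    assume "G = bot"
    then obtain P Q where P: "eventually P (filtercomap \<Phi> (nhds l))" and Q: "eventually Q F"
      and PQ: "\<And>x. P x \<Longrightarrow> Q x \<Longrightarrow> False"
      unfolding trivial_limit_def G_def eventually_inf by blast
    obtain P' where P': "eventually P' (nhds l)" "\<And>x. P' (\<Phi> x) \<Longrightarrow> P x"
      using P by (auto simp: eventually_filtercomap)
    \<comment> \<open>\<open>P'\<close> pulls back into \<open>P\<close>, which excludes
      \<open>Q\<close>, and \<open>Q\<close> holds eventually along \<open>F\<close>. So the image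
      filter would avoid a neighbourhood of its cluster point \<open>l\<close>.\<close>
    have "\<forall>\<^sub>F y in filtermap \<Phi> F. \<not> P' y"
      unfolding eventually_filtermap using Q by eventually_elim (use P' PQ in blast)
    with P'(1) have "inf (nhds l) (filtermap \<Phi> F) = bot"
      unfolding trivial_limit_def eventually_inf by blast
    with l show False by simp
  qed
  moreover have "(f i \<longlongrightarrow> l i) G" for i
  proof -
    have "(\<Phi> \<longlongrightarrow> l) G"
      unfolding G_def by (rule filterlim_mono[OF filterlim_filtercomap]) auto
    then have "((\<lambda>x. \<Phi> x i) \<longlongrightarrow> l i) G"
      by (rule continuous_on_tendsto_compose[OF continuous_on_product_coordinates]) simp_all
    then show ?thesis by (simp add: \<Phi>_def)
  qed
  ultimately show thesis
    using l(1) by (intro that[of G l]) (auto simp: G_def)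
qed

lemma freq2_in_unit_interval: "freq2 C n \<in> {0..1}"
proof (cases n)
  case (Pair n1 n2)
  have "card (C \<inter> ({1..n1} \<times> {1..n2})) \<le> card ({1..n1} \<times> {1..n2})"
    by (rule card_mono) auto
  also have "\<dots> = n1 * n2"
    by (simp add: card_cartesian_product)
  finally have "real (card (C \<inter> ({1..n1} \<times> {1..n2}))) \<le> real n1 * real n2"
    by (metis of_nat_le_iff of_nat_mult)
  \<comment> \<open>If \<open>n1\<close> or \<open>n2\<close> is 0, the quotient is 0 by the
    convention for division by zero, so the bound holds at every pair.\<close>
  then show ?thesis
    by (simp add: freq2_def Pair divide_le_eq_1_pos divide_simps zero_less_mult_iff)
qed

lemma freq2_Un_disjoint:
  assumes "A \<inter> B = {}"
  shows "freq2 (A \<union> B) n = freq2 A n + freq2 B n"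
proof (cases n)
  case (Pair n1 n2)
  have "card ((A \<union> B) \<inter> ({1..n1} \<times> {1..n2}))
      = card (A \<inter> ({1..n1} \<times> {1..n2})) + card (B \<inter> ({1..n1} \<times> {1..n2}))"
    unfolding Int_Un_distrib2 using assms by (intro card_Un_disjoint) auto
  then show ?thesis
    by (simp add: freq2_def Pair add_divide_distrib)
qed

lemma freq2_pos_nat2:
  assumes "n1 \<ge> 1" "n2 \<ge> 1"
  shows "freq2 pos_nat2 (n1, n2) = 1"
proof -
  have "pos_nat2 \<inter> ({1..n1} \<times> {1..n2}) = {1..n1} \<times> {1..n2}"
    by (auto simp: pos_nat2_def)
  then show ?thesis
    using assms by (simp add: freq2_def card_cartesian_product)
qed

theorem theorem3p1:
  shows "\<exists>\<nu> :: (nat \<times> nat) set \<Rightarrow> real.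
           finitely_additive_probability pos_nat2 \<nu> \<and> (\<forall>C\<in>C_F2. \<nu> C = mu2 C)"
proof -
  have "\<forall>\<^sub>F n in min_at_top. \<forall>C. freq2 C n \<in> {0..1}"
    using freq2_in_unit_interval by (intro always_eventually) blast
  then obtain G \<nu> where G: "G \<le> min_at_top" "G \<noteq> bot"
    and range: "\<And>C. \<nu> C \<in> {0..1}" and lim: "\<And>C. (freq2 C \<longlongrightarrow> \<nu> C) G"
    \<comment> \<open>The index type consists of the sets \<open>C\<close> themselves, so the limit
      point of the product is directly a set function \<open>\<nu>\<close>.\<close>
    using simultaneously_convergent_subfilter[of min_at_top "\<lambda>_. {0..1}" freq2]
      min_at_top_neq_bot compact_Icc by metis
  have limit_eq: "\<nu> C = l" if "(freq2 C \<longlongrightarrow> l) min_at_top" for C l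
    using tendsto_unique[OF G(2) lim tendsto_mono[OF G(1) that]] .
  \<comment> \<open>Only eventually: the frequency is 0 at pairs with a zero coordinate.\<close>
  have "\<forall>\<^sub>F n in min_at_top. freq2 pos_nat2 n = 1"
    unfolding eventually_min_at_top using freq2_pos_nat2 by blast
  then have "\<nu> pos_nat2 = 1"
    by (intro limit_eq tendsto_eventually)
  moreover have "\<nu> (A \<union> B) = \<nu> A + \<nu> B" if "A \<inter> B = {}" for A B
  proof (rule tendsto_unique[OF G(2) lim])
    show "(freq2 (A \<union> B) \<longlongrightarrow> \<nu> A + \<nu> B) G"
      using tendsto_add[OF lim[of A] lim[of B]] by (simp add: freq2_Un_disjoint[OF that, abs_def])
  qed
  ultimately have "finitely_additive_probability pos_nat2 \<nu>"
    using range by (auto simp: finitely_additive_probability_def)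
  moreover have "\<nu> C = mu2 C" if "C \<in> C_F2" for C
  proof -
    obtain l where l: "(freq2 C \<longlongrightarrow> l) min_at_top"
      using \<open>C \<in> C_F2\<close> by (auto simp: C_F2_def)
    \<comment> \<open>\<open>Lim\<close> is a definite description; it equals \<open>l\<close>
      because limits along a proper filter are unique.\<close>
    then show ?thesis
      using limit_eq[OF l] tendsto_Lim[OF min_at_top_neq_bot l] by (simp add: mu2_def)
  qed
  ultimately show ?thesis by blast
qed

end
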